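(* Let $u(n,t)$ be a solution to the discrete wave equation. Then $$E(t):=-\sum_{n=-\infty}^{\infty}\overline{u(n,t)}\cdot\Big(\frac{u(n+2,t)-2u(n,t)+u(n-2,t)}4\Big)+\sum_{n=-\infty}^{\infty}\Big|\frac{u(n,t+1)-u(n,t-1)}2\Big|^2$$ $$=\Big\|\frac{u(n+1,t)-u(n-1,t)}2\Big\|^2_{\ell^2(\mathbb{Z},n)}+\Big\|\frac{u(n,t+1)-u(n,t-1)}2\Big\|^2_{\ell^2(\mathbb{Z},n)}$$ is independent of $t$.
   Context: A solution to the discrete wave equation is a function $u:\mathbb{Z}\times\mathbb{Z}\to\mathbb{C}$ with $u(n,t+1)+u(n,t-1)=u(n+1,t)+u(n-1,t)$ for all $n,t\in\mathbb{Z}$. The notation $\|\cdot\|_{\ell^2(\mathbb{Z},n)}$ means the $\ell^2(\mathbb{Z})$-norm in the variable $n$, with $t$ fixed.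
   Formalization: The claims are made only at times t where the first series in E(t) converges (unconditionally) and both norms are finite; without this the equality fails, e.g. for u(n,t)=n, where the first expression is 0 and the second is infinite. *)

theory Defs
  imports "HOL-Analysis.Analysis"
begin

definition discrete_wave_solution :: "(int \<Rightarrow> int \<Rightarrow> complex) \<Rightarrow> bool" where
  "discrete_wave_solution u \<longleftrightarrow>
     (\<forall>n t. u n (t + 1) + u n (t - 1) = u (n + 1) t + u (n - 1) t)"

definition in_ell2 :: "(int \<Rightarrow> complex) \<Rightarrow> bool" where
  "in_ell2 f \<longleftrightarrow> (\<lambda>n. (cmod (f n))\<^sup>2) summable_on UNIV"

text \<open>Meaningful only when \<open>in_ell2 f\<close> holds: otherwise \<open>infsum\<close> returns the junk value 0.\<close>

definition ell2_norm :: "(int \<Rightarrow> complex) \<Rightarrow> real" where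
  "ell2_norm f = sqrt (\<Sum>\<^sub>\<infinity>n. (cmod (f n))\<^sup>2)"

definition wave_energy :: "(int \<Rightarrow> int \<Rightarrow> complex) \<Rightarrow> int \<Rightarrow> complex" where
  "wave_energy u t =
     - (\<Sum>\<^sub>\<infinity>n. cnj (u n t) * ((u (n + 2) t - 2 * u n t + u (n - 2) t) / 4))
     + complex_of_real (\<Sum>\<^sub>\<infinity>n. (cmod ((u n (t + 1) - u n (t - 1)) / 2))\<^sup>2)"

text \<open>The series and norms occurring in the two expressions for the energy at time \<open>t\<close> are all
  finite. For the solution \<open>u n t = n\<close> the series in \<open>wave_energy\<close> vanish termwise while the
  \<open>\<ell>\<^sup>2\<close> norm of the spatial difference is infinite, so finiteness of that norm has to be required
  separately. Everything holds if \<open>u\<close> is square-summable in \<open>n\<close>; see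
  \<open>wave_energy_finite_if_ell2\<close>.\<close>

definition wave_energy_finite :: "(int \<Rightarrow> int \<Rightarrow> complex) \<Rightarrow> int \<Rightarrow> bool" where
  "wave_energy_finite u t \<longleftrightarrow>
     (\<lambda>n. cnj (u n t) * ((u (n + 2) t - 2 * u n t + u (n - 2) t) / 4)) summable_on UNIV \<and>
     in_ell2 (\<lambda>n. (u (n + 1) t - u (n - 1) t) / 2) \<and>
     in_ell2 (\<lambda>n. (u n (t + 1) - u n (t - 1)) / 2)"

lemma in_ell2_shift:
  assumes "in_ell2 f"
  shows "in_ell2 (\<lambda>n. f (n + k))"
proof -
  have "bij_betw (\<lambda>n::int. n + k) UNIV UNIV"
    by (rule bij_betw_byWitness[where f' = "\<lambda>n. n - k"]) auto
  from summable_on_reindex_bij_betw[OF this, of "\<lambda>n. (cmod (f n))\<^sup>2"] show ?thesis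
    using assms by (simp add: in_ell2_def)
qed

lemma in_ell2_diff:
  assumes "in_ell2 f" "in_ell2 g"
  shows "in_ell2 (\<lambda>n. f n - g n)"
  unfolding in_ell2_def
proof (rule summable_on_comparison_test)
  show "(\<lambda>n. 2 * (cmod (f n))\<^sup>2 + 2 * (cmod (g n))\<^sup>2) summable_on UNIV"
    using assms unfolding in_ell2_def by (intro summable_on_add summable_on_cmult_right)
  show "(cmod (f n - g n))\<^sup>2 \<le> 2 * (cmod (f n))\<^sup>2 + 2 * (cmod (g n))\<^sup>2" for n
  proof -
    have "(cmod (f n - g n))\<^sup>2 \<le> (cmod (f n) + cmod (g n))\<^sup>2"
      by (intro power_mono norm_triangle_ineq4) simp
    also have "\<dots> \<le> 2 * (cmod (f n))\<^sup>2 + 2 * (cmod (g n))\<^sup>2"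
      using sum_squares_bound[of "cmod (f n)" "cmod (g n)"]
      by (simp add: power2_sum)
    finally show ?thesis .
  qed
qed auto

lemma in_ell2_cmult:
  assumes "in_ell2 f"
  shows "in_ell2 (\<lambda>n. c * f n)"
  using assms unfolding in_ell2_def
  by (simp add: norm_mult power_mult_distrib summable_on_cmult_right)

lemma summable_cnj_mult:
  assumes "in_ell2 f" "in_ell2 g"
  shows "(\<lambda>n. cnj (f n) * g n) summable_on UNIV"
proof (rule abs_summable_summable, rule summable_on_comparison_test)
  show "(\<lambda>n. (cmod (f n))\<^sup>2 + (cmod (g n))\<^sup>2) summable_on UNIV"
    using assms unfolding in_ell2_def by (intro summable_on_add)
  show "norm (cnj (f n) * g n) \<le> (cmod (f n))\<^sup>2 + (cmod (g n))\<^sup>2" for n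
    using sum_squares_bound[of "cmod (f n)" "cmod (g n)"]
      mult_nonneg_nonneg[OF norm_ge_zero[of "f n"] norm_ge_zero[of "g n"]]
    unfolding norm_mult complex_mod_cnj by linarith
qed auto

lemma wave_energy_finite_if_ell2:
  assumes ell2: "\<And>t. in_ell2 (\<lambda>n. u n t)"
  shows "wave_energy_finite u t"
proof -
  have half: "in_ell2 (\<lambda>n. (f n - g n) / 2)" if "in_ell2 f" "in_ell2 g" for f g
    using in_ell2_cmult[OF in_ell2_diff[OF that], of "1/2"] by simp
  have shift: "in_ell2 (\<lambda>n. u (n + k) t)" for k
    by (rule in_ell2_shift[OF ell2])
  have shift': "in_ell2 (\<lambda>n. u (n - k) t)" for k
    using shift[of "- k"] by simp
  have "in_ell2 (\<lambda>n. 1/4 * (u (n + 2) t - (2 * u n t - u (n - 2) t)))"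
    by (intro in_ell2_cmult in_ell2_diff shift shift' ell2)
  then have "in_ell2 (\<lambda>n. (u (n + 2) t - 2 * u n t + u (n - 2) t) / 4)"
    by (simp add: algebra_simps add_divide_distrib diff_divide_distrib)
  then show ?thesis
    unfolding wave_energy_finite_def
    by (intro conjI summable_cnj_mult half shift shift' ell2)
qed

end

theory Submission
  imports Defs
begin

text \<open>
  The two halves of the proposition rest on different ideas.

  \<^emph>\<open>The two expressions for the energy agree\<close> at a time \<open>t\<close>. For \<open>f n = u n t\<close> and
  \<open>D n = f (n + 1) - f (n - 1)\<close> this is a summation by parts: termwise, the two series differ by
  a telescoping series whose partial sums are boundary terms of the form \<open>cnj (f m) * D (m + 1)\<close>
  (up to bounded shifts). As \<open>f\<close> itself need not be square-summable, or even bounded, it is not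
  immediate that these vanish. But \<open>D\<close> is square-summable, so Cauchy-Schwarz gives
  \<open>f n = O(sqrt \<bar>n\<bar>)\<close>; if the boundary contribution of the window from \<open>-n\<close> to \<open>n\<close> stayed away from
  zero, then \<open>\<bar>D\<bar>\<^sup>2\<close> summed over a few points near \<open>-n\<close> and \<open>n\<close> would dominate a multiple of
  \<open>1 / n\<close>, whose series diverges (\<open>boundary_limit_zero\<close>). This contribution does converge as \<open>n\<close>
  grows, since both series do, so its limit is zero (\<open>summation_by_parts_step2\<close>).

  \<^emph>\<open>Conservation\<close> is d'Alembert's decomposition into two travelling waves. Let \<open>d\<close> and \<open>e\<close> be the
  centred differences in space and time. The wave equation says that \<open>d + e\<close> and \<open>d - e\<close> at time
  \<open>t + 1\<close> are the translates by one step, in opposite directions, of the same functions at time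
  \<open>t\<close>. Translation preserves the \<open>\<ell>\<^sup>2\<close> norm, and by the parallelogram law
  \<open>\<bar>d\<bar>\<^sup>2 + \<bar>e\<bar>\<^sup>2 = (\<bar>d + e\<bar>\<^sup>2 + \<bar>d - e\<bar>\<^sup>2) / 2\<close>. Composing the translations compares any
  two times.
\<close>

section \<open>Vanishing of boundary terms\<close>

lemma summable_square_add:
  fixes a b :: "nat \<Rightarrow> real"
  assumes "summable (\<lambda>n. (a n)\<^sup>2)" "summable (\<lambda>n. (b n)\<^sup>2)"
  shows "summable (\<lambda>n. (a n + b n)\<^sup>2)"
proof (rule summable_comparison_test')
  show "summable (\<lambda>n. 2 * (a n)\<^sup>2 + 2 * (b n)\<^sup>2)"
    using assms by (intro summable_add summable_mult)
  show "norm ((a n + b n)\<^sup>2) \<le> 2 * (a n)\<^sup>2 + 2 * (b n)\<^sup>2" if "n \<ge> 0" for n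
    using sum_squares_bound[of "a n" "b n"]
    unfolding real_norm_def abs_power2 unfolding power2_sum by linarith
qed

text \<open>Square-summable increments let \<open>G\<close> grow at most like \<open>sqrt n\<close>. So if \<open>\<bar>X n\<bar> \<ge> c > 0\<close> for all
  large \<open>n\<close>, then \<open>(E n)\<^sup>2 \<ge> c\<^sup>2 / (G n)\<^sup>2\<close> is at least a multiple of \<open>1 / (n + 1)\<close>, contrary to the
  divergence of the harmonic series. The argument makes \<open>G n * E n\<close> small only along a
  subsequence; convergence of \<open>X\<close> turns this into a statement about its limit.\<close>

lemma boundary_limit_zero:
  fixes G E :: "nat \<Rightarrow> real" and X :: "nat \<Rightarrow> 'a::real_normed_vector"
  assumes G_nonneg: "\<And>n. 0 \<le> G n"
    and G_step: "\<And>n. G (Suc n) \<le> G n + E n"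
    and E_summable: "summable (\<lambda>n. (E n)\<^sup>2)"
    and X_bound: "\<And>n. norm (X n) \<le> G n * E n"
    and X_lim: "X \<longlonglongrightarrow> L"
  shows "L = 0"
proof (rule ccontr)
  assume "L \<noteq> 0"
  define c where "c = norm L / 2"
  have c: "c > 0" "c < norm L" using \<open>L \<noteq> 0\<close> by (auto simp: c_def)
  have "eventually (\<lambda>n. c < norm (X n)) sequentially"
    using order_tendstoD(1)[OF tendsto_norm[OF X_lim] c(2)] .
  then obtain N where N: "\<And>n. n \<ge> N \<Longrightarrow> c < norm (X n)"
    by (auto simp: eventually_sequentially)
  define S where "S = (\<Sum>n. (E n)\<^sup>2)"
  define B where "B = 2 * (G 0)\<^sup>2 + 2 * S"
  have S: "(\<Sum>k<n. (E k)\<^sup>2) \<le> S" for n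
    unfolding S_def by (rule sum_le_suminf[OF E_summable]) auto
  have S0: "S \<ge> 0" using S[of 0] by simp
  have G_le: "G n \<le> G 0 + (\<Sum>k<n. E k)" for n
  proof (induction n)
    case (Suc n)
    then show ?case using G_step[of n] by simp
  qed simp
  have G_sq: "(G n)\<^sup>2 \<le> B * (real n + 1)" for n
  proof -
    have "(\<Sum>k<n. E k)\<^sup>2 \<le> real n * (\<Sum>k<n. (E k)\<^sup>2)"
      using sum_squared_le_sum_of_squares[of E "{..<n}"] by (simp add: mult.commute)
    also have "\<dots> \<le> real n * S" by (intro mult_left_mono S) simp
    finally have 1: "(\<Sum>k<n. E k)\<^sup>2 \<le> real n * S" .
    have "(G n)\<^sup>2 \<le> (G 0 + (\<Sum>k<n. E k))\<^sup>2"
      by (intro power_mono G_le G_nonneg)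
    also have "\<dots> \<le> 2 * (G 0)\<^sup>2 + 2 * (\<Sum>k<n. E k)\<^sup>2"
      using sum_squares_bound[of "G 0" "\<Sum>k<n. E k"] by (simp add: power2_sum)
    also have "\<dots> \<le> 2 * (G 0)\<^sup>2 + 2 * (real n * S)" using 1 by simp
    also have "\<dots> \<le> B * (real n + 1)"
      using S0 by (simp add: B_def algebra_simps)
    finally show ?thesis .
  qed
  have "summable (\<lambda>n. c\<^sup>2 * inverse (real (Suc n)))"
  proof (rule summable_comparison_test')
    show "summable (\<lambda>n. B * (E n)\<^sup>2)" using E_summable by (rule summable_mult)
    fix n assume "n \<ge> N"
    have "c\<^sup>2 \<le> (G n * E n)\<^sup>2"
      using N[OF \<open>n \<ge> N\<close>] X_bound[of n] c by (intro power_mono) auto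
    also have "\<dots> \<le> B * (real n + 1) * (E n)\<^sup>2"
      unfolding power_mult_distrib by (intro mult_right_mono G_sq) simp
    finally show "norm (c\<^sup>2 * inverse (real (Suc n))) \<le> B * (E n)\<^sup>2"
      by (simp add: field_simps)
  qed
  then have "summable (\<lambda>n. inverse (real (Suc n)))"
    using c by simp
  then have "summable (\<lambda>n. inverse (real n))"
    by (simp only: summable_Suc_iff[of "\<lambda>n. inverse (real n)"])
  then show False
    using not_summable_harmonic[where 'a = real] by blast
qed

section \<open>Summation by parts\<close>

lemma has_sum_int_symmetric_limit:
  fixes c :: "int \<Rightarrow> 'a::{comm_monoid_add,topological_space}"
  assumes "(c has_sum s) UNIV"
  shows "(\<lambda>n. \<Sum>k\<in>{- int n..<int n}. c k) \<longlonglongrightarrow> s"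
proof -
  have "filterlim (\<lambda>n. {- int n..<int n}) (finite_subsets_at_top UNIV) sequentially"
    unfolding filterlim_finite_subsets_at_top
  proof (intro allI impI)
    fix X :: "int set" assume "finite X \<and> X \<subseteq> UNIV"
    then have fin: "finite (abs ` X)" by simp
    show "\<forall>\<^sub>F n in sequentially. finite {- int n..<int n} \<and> X \<subseteq> {- int n..<int n} \<and>
            {- int n..<int n} \<subseteq> UNIV"
      unfolding eventually_sequentially
    proof (intro exI allI impI)
      fix n assume n: "nat (Max (insert 0 (abs ` X)) + 1) \<le> n"
      have "x \<in> {- int n..<int n}" if "x \<in> X" for x
      proof -
        have "\<bar>x\<bar> \<le> Max (insert 0 (abs ` X))" using that fin by (intro Max_ge) auto
        then show ?thesis using n by auto
      qed
      then show "finite {- int n..<int n} \<and> X \<subseteq> {- int n..<int n} \<and> {- int n..<int n} \<subseteq> UNIV"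
        by auto
    qed
  qed
  then show ?thesis
    using assms unfolding has_sum_def by (rule filterlim_compose[rotated])
qed

lemma sum_telescope_int_symmetric:
  fixes H :: "int \<Rightarrow> 'a::ab_group_add"
  shows "(\<Sum>k\<in>{- int n..<int n}. H k - H (k + 1)) = H (- int n) - H (int n)"
proof (induction n)
  case (Suc n)
  have "{- int (Suc n)..<int (Suc n)} = insert (- int n - 1) (insert (int n) {- int n..<int n})"
    by auto
  moreover have "- int n - 1 = - int (Suc n)" by simp
  ultimately show ?case using Suc by (simp add: algebra_simps)
qed simp

lemma in_ell2_summable_subsequence:
  assumes "in_ell2 f" "inj i"
  shows "summable (\<lambda>n. (cmod (f (i n)))\<^sup>2)"
proof -
  have "(\<lambda>n. (cmod (f n))\<^sup>2) summable_on range i"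
    using assms unfolding in_ell2_def by (rule_tac summable_on_subset_banach) auto
  then have "(\<lambda>n. (cmod (f (i n)))\<^sup>2) summable_on UNIV"
    using summable_on_reindex[OF assms(2), of "\<lambda>n. (cmod (f n))\<^sup>2"] by (simp add: o_def)
  then show ?thesis by (rule summable_on_imp_summable)
qed

lemma infsum_shift_int:
  fixes f :: "int \<Rightarrow> 'a::{comm_monoid_add,t2_space}"
  shows "(\<Sum>\<^sub>\<infinity>n. f (n + k)) = (\<Sum>\<^sub>\<infinity>n. f n)"
  by (rule infsum_reindex_bij_betw) (rule bij_betw_byWitness[where f' = "\<lambda>n. n - k"], auto)

text \<open>With \<open>h n = cnj (f (n - 1)) * (f (n + 1) - f (n - 1))\<close>, the termwise difference of the two
  series, after moving the first by one step, is a multiple of \<open>h n - h (n + 2)\<close>. Writing this as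
  \<open>H n - H (n + 1)\<close> with \<open>H n = h n + h (n + 1)\<close> makes it telescope in unit steps, so that even
  and odd \<open>n\<close> need not be separated.\<close>

lemma summation_by_parts_step2:
  fixes f :: "int \<Rightarrow> complex"
  assumes sec: "(\<lambda>n. cnj (f n) * ((f (n + 2) - 2 * f n + f (n - 2)) / 4)) summable_on UNIV"
    and ell2: "in_ell2 (\<lambda>n. (f (n + 1) - f (n - 1)) / 2)"
  shows "- (\<Sum>\<^sub>\<infinity>n. cnj (f n) * ((f (n + 2) - 2 * f n + f (n - 2)) / 4)) =
         complex_of_real (\<Sum>\<^sub>\<infinity>n. (cmod ((f (n + 1) - f (n - 1)) / 2))\<^sup>2)"
proof -
  define a where "a n = cnj (f n) * ((f (n + 2) - 2 * f n + f (n - 2)) / 4)" for n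
  define D where "D n = f (n + 1) - f (n - 1)" for n
  define b where "b n = (cmod (D n / 2))\<^sup>2" for n
  define H where "H n = (cnj (f (n - 1)) * D n + cnj (f n) * D (n + 1)) / 4" for n

  have "a summable_on UNIV" using sec by (simp add: a_def[abs_def])
  moreover have "bij_betw (\<lambda>n::int. n + 1) UNIV UNIV"
    by (rule bij_betw_byWitness[where f' = "\<lambda>n. n - 1"]) auto
  ultimately have "(\<lambda>n. a (n + 1)) summable_on UNIV"
    by (subst summable_on_reindex_bij_betw)
  then have a: "((\<lambda>n. a (n + 1)) has_sum (\<Sum>\<^sub>\<infinity>n. a n)) UNIV"
    unfolding infsum_shift_int[of a 1, symmetric] by (rule has_sum_infsum)
  have "b summable_on UNIV" using ell2 by (simp add: b_def[abs_def] D_def in_ell2_def)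
  then have b: "((\<lambda>n. complex_of_real (b n)) has_sum complex_of_real (\<Sum>\<^sub>\<infinity>n. b n)) UNIV"
    by (intro has_sum_of_real has_sum_infsum)
  define s where "s = - (\<Sum>\<^sub>\<infinity>n. a n) - complex_of_real (\<Sum>\<^sub>\<infinity>n. b n)"
  have "- a (n + 1) - complex_of_real (b n) = H n - H (n + 1)" for n
  proof -
    have idx: "n + 1 + 2 = n + 3" "n + 1 - 2 = n - 1" "n + 1 - 1 = n" "n + 1 + 1 = n + 2"
      "n + 2 + 1 = n + 3" "n + 2 - 1 = n + 1" by auto
    show ?thesis
      unfolding a_def b_def H_def D_def complex_norm_square idx
      by (simp add: field_simps)
  qed
  moreover have "((\<lambda>n. - a (n + 1) - complex_of_real (b n)) has_sum s) UNIV"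
    unfolding s_def diff_conv_add_uminus[of "- _"] using a b
    by (intro has_sum_add) (simp_all only: has_sum_uminus minus_minus)
  ultimately have "((\<lambda>n. H n - H (n + 1)) has_sum s) UNIV" by simp
  then have lim: "(\<lambda>n. H (- int n) - H (int n)) \<longlonglongrightarrow> s"
    unfolding sum_telescope_int_symmetric[symmetric] by (rule has_sum_int_symmetric_limit)

  \<comment> \<open>Both ends of the symmetric window are treated at once: \<open>G\<close> collects the values of \<open>f\<close> at the
    two ends, and \<open>E\<close> the differences that occur there or that bound the growth of \<open>G\<close>.\<close>
  define G where "G n = cmod (f (int n - 1)) + cmod (f (int n))
      + cmod (f (- int n - 1)) + cmod (f (- int n))" for n
  define E where "E n = cmod (D (int n)) + cmod (D (int n + 1))
      + cmod (D (- int n)) + cmod (D (- int n + 1)) + cmod (D (- int n - 1))" for n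
  have D: "in_ell2 D"
  proof -
    have "D = (\<lambda>n. 2 * ((f (n + 1) - f (n - 1)) / 2))" by (auto simp: D_def field_simps)
    then show ?thesis using in_ell2_cmult[OF ell2, of 2] by simp
  qed
  have H_bound: "cmod (H m) \<le> cmod (f (m - 1)) * cmod (D m) + cmod (f m) * cmod (D (m + 1))"
    for m
  proof -
    have "cmod (H m) \<le> cmod (cnj (f (m - 1)) * D m + cnj (f m) * D (m + 1))"
      by (simp add: H_def norm_divide)
    also have "\<dots> \<le> cmod (cnj (f (m - 1)) * D m) + cmod (cnj (f m) * D (m + 1))"
      by (rule norm_triangle_ineq)
    finally show ?thesis by (simp add: norm_mult)
  qed
  have "s = 0"
  proof (rule boundary_limit_zero[OF _ _ _ _ lim])
    show "0 \<le> G n" for n by (simp add: G_def)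
    show "G (Suc n) \<le> G n + E n" for n
    proof -
      have "cmod (f (int n + 1)) \<le> cmod (f (int n - 1)) + cmod (D (int n))"
        unfolding D_def using norm_triangle_sub[of "f (int n + 1)" "f (int n - 1)"] by simp
      moreover have "cmod (f (- int n - 2)) \<le> cmod (f (- int n)) + cmod (D (- int n - 1))"
      proof -
        have idx: "- int n - 1 + 1 = - int n" "- int n - 1 - 1 = - int n - 2" by auto
        show ?thesis
          unfolding D_def idx using norm_triangle_sub[of "f (- int n - 2)" "f (- int n)"]
          by (simp only: norm_minus_commute)
      qed
      moreover have "G (Suc n) = cmod (f (int n)) + cmod (f (int n + 1))
          + cmod (f (- int n - 2)) + cmod (f (- int n - 1))"
      proof -
        have idx: "int (Suc n) - 1 = int n" "int (Suc n) = int n + 1"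
          "- (int n + 1) = - int n - 1" "- int n - 1 - 1 = - int n - 2" by auto
        show ?thesis unfolding G_def idx by simp
      qed
      moreover have "E n \<ge> cmod (D (int n)) + cmod (D (- int n - 1))"
        by (simp add: E_def)
      ultimately show ?thesis unfolding G_def by linarith
    qed
    show "summable (\<lambda>n. (E n)\<^sup>2)"
      unfolding E_def
      by (intro summable_square_add in_ell2_summable_subsequence[OF D]) (auto intro: injI)
    show "norm (H (- int n) - H (int n)) \<le> G n * E n" for n
    proof -
      have fG: "cmod (f (int n - 1)) \<le> G n" "cmod (f (int n)) \<le> G n"
        "cmod (f (- int n - 1)) \<le> G n" "cmod (f (- int n)) \<le> G n"
        by (simp_all add: G_def)
      have "norm (H (- int n) - H (int n)) \<le> norm (H (- int n)) + norm (H (int n))"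
        by (rule norm_triangle_ineq4)
      also have "\<dots> \<le> cmod (f (- int n - 1)) * cmod (D (- int n))
            + cmod (f (- int n)) * cmod (D (- int n + 1))
          + (cmod (f (int n - 1)) * cmod (D (int n))
            + cmod (f (int n)) * cmod (D (int n + 1)))"
        by (intro add_mono H_bound)
      also have "\<dots> \<le> G n * cmod (D (- int n)) + G n * cmod (D (- int n + 1))
          + (G n * cmod (D (int n)) + G n * cmod (D (int n + 1)))"
        by (intro add_mono mult_right_mono fG) simp_all
      also have "\<dots> = G n * (cmod (D (- int n)) + cmod (D (- int n + 1))
          + cmod (D (int n)) + cmod (D (int n + 1)))"
        by (simp add: algebra_simps)
      also have "\<dots> \<le> G n * E n"
        by (intro mult_left_mono) (simp_all add: E_def G_def)
      finally show ?thesis .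
    qed
  qed
  then show ?thesis by (simp add: s_def a_def b_def D_def)
qed

section \<open>Travelling waves\<close>

lemma int_shift_invariant:
  fixes P :: "int \<Rightarrow> 'a"
  assumes "\<And>t. P (t + 1) = P t"
  shows "P s = P t"
proof -
  have "P t = P 0" for t
  proof (induction t rule: int_induct[where k = 0])
    case (step1 i)
    then show ?case by (simp only: assms)
  next
    case (step2 i)
    then show ?case using assms[of "i - 1"] by simp
  qed simp
  then show ?thesis by metis
qed

text \<open>The differences of \<open>u\<close> along the two characteristic directions of the grid. For a solution
  these are the sum and the difference of the centred differences in space and time, and each of
  them is transported unchanged along the other direction.\<close>

definition left_wave :: "(int \<Rightarrow> int \<Rightarrow> complex) \<Rightarrow> int \<Rightarrow> int \<Rightarrow> complex" where
  "left_wave u t n = u n (t + 1) - u (n - 1) t"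

definition right_wave :: "(int \<Rightarrow> int \<Rightarrow> complex) \<Rightarrow> int \<Rightarrow> int \<Rightarrow> complex" where
  "right_wave u t n = u (n + 1) t - u n (t + 1)"

lemma
  assumes "discrete_wave_solution u"
  shows left_wave_transport: "left_wave u (t + 1) n = left_wave u t (n + 1)"
    and right_wave_transport: "right_wave u (t + 1) n = right_wave u t (n - 1)"
proof -
  have "u n (t + 1 + 1) + u n (t + 1 - 1) = u (n + 1) (t + 1) + u (n - 1) (t + 1)"
    using assms unfolding discrete_wave_solution_def by blast
  then show "left_wave u (t + 1) n = left_wave u t (n + 1)"
    and "right_wave u (t + 1) n = right_wave u t (n - 1)"
    by (simp_all add: left_wave_def right_wave_def algebra_simps)
qed

lemma
  assumes "discrete_wave_solution u"
  shows left_wave_eq: "left_wave u t n =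
      (u (n + 1) t - u (n - 1) t) / 2 + (u n (t + 1) - u n (t - 1)) / 2"
    and right_wave_eq: "right_wave u t n =
      (u (n + 1) t - u (n - 1) t) / 2 - (u n (t + 1) - u n (t - 1)) / 2"
proof -
  have "u n (t + 1) + u n (t - 1) = u (n + 1) t + u (n - 1) t"
    using assms unfolding discrete_wave_solution_def by blast
  then have eq: "u n (t - 1) = u (n + 1) t + u (n - 1) t - u n (t + 1)"
    by (simp add: algebra_simps)
  show "left_wave u t n = (u (n + 1) t - u (n - 1) t) / 2 + (u n (t + 1) - u n (t - 1)) / 2"
    and "right_wave u t n = (u (n + 1) t - u (n - 1) t) / 2 - (u n (t + 1) - u n (t - 1)) / 2"
    unfolding left_wave_def right_wave_def eq by (simp_all add: field_simps)
qed

lemma ell2_norm_shift: "ell2_norm (\<lambda>n. f (n + k)) = ell2_norm f"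
  unfolding ell2_norm_def using infsum_shift_int[of "\<lambda>n. (cmod (f n))\<^sup>2" k] by simp

lemma
  assumes "discrete_wave_solution u"
  shows ell2_norm_left_wave_const: "ell2_norm (left_wave u s) = ell2_norm (left_wave u t)"
    and ell2_norm_right_wave_const: "ell2_norm (right_wave u s) = ell2_norm (right_wave u t)"
proof -
  have "left_wave u (t + 1) = (\<lambda>n. left_wave u t (n + 1))"
    and "right_wave u (t + 1) = (\<lambda>n. right_wave u t (n + -1))" for t
    using left_wave_transport[OF assms] right_wave_transport[OF assms] by auto
  then have "ell2_norm (left_wave u (t + 1)) = ell2_norm (left_wave u t)"
    and "ell2_norm (right_wave u (t + 1)) = ell2_norm (right_wave u t)" for t
    by (simp_all only: ell2_norm_shift)
  then show "ell2_norm (left_wave u s) = ell2_norm (left_wave u t)"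
    and "ell2_norm (right_wave u s) = ell2_norm (right_wave u t)"
    using int_shift_invariant[of "\<lambda>t. ell2_norm (left_wave u t)" s t]
      int_shift_invariant[of "\<lambda>t. ell2_norm (right_wave u t)" s t]
    by blast+
qed

lemma ell2_norm_square: "(ell2_norm f)\<^sup>2 = (\<Sum>\<^sub>\<infinity>n. (cmod (f n))\<^sup>2)"
  unfolding ell2_norm_def by (simp add: infsum_nonneg)

lemma ell2_parallelogram:
  assumes f: "in_ell2 f" and g: "in_ell2 g"
  shows "(ell2_norm (\<lambda>n. f n + g n))\<^sup>2 + (ell2_norm (\<lambda>n. f n - g n))\<^sup>2 =
         2 * ((ell2_norm f)\<^sup>2 + (ell2_norm g)\<^sup>2)"
proof -
  have "in_ell2 (\<lambda>n. f n - (- 1) * g n)" by (intro in_ell2_diff in_ell2_cmult f g)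
  then have plus: "in_ell2 (\<lambda>n. f n + g n)" by simp
  have minus: "in_ell2 (\<lambda>n. f n - g n)" by (rule in_ell2_diff[OF f g])
  have "(\<Sum>\<^sub>\<infinity>n. (cmod (f n + g n))\<^sup>2) + (\<Sum>\<^sub>\<infinity>n. (cmod (f n - g n))\<^sup>2)
      = (\<Sum>\<^sub>\<infinity>n. (cmod (f n + g n))\<^sup>2 + (cmod (f n - g n))\<^sup>2)"
    using plus minus unfolding in_ell2_def by (rule infsum_add[symmetric])
  also have "\<dots> = (\<Sum>\<^sub>\<infinity>n. 2 * ((cmod (f n))\<^sup>2 + (cmod (g n))\<^sup>2))"
    by (intro infsum_cong) (simp only: cmod_power2, simp add: power2_eq_square algebra_simps)
  also have "\<dots> = 2 * ((\<Sum>\<^sub>\<infinity>n. (cmod (f n))\<^sup>2) + (\<Sum>\<^sub>\<infinity>n. (cmod (g n))\<^sup>2))"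
    using f g unfolding in_ell2_def
    by (simp only: infsum_cmult_right' infsum_add)
  finally show ?thesis unfolding ell2_norm_square .
qed

section \<open>Conservation of the energy\<close>

theorem proposition2p17:
  fixes u :: "int \<Rightarrow> int \<Rightarrow> complex"
  assumes "discrete_wave_solution u"
  shows "(\<forall>t. wave_energy_finite u t \<longrightarrow>
            wave_energy u t = complex_of_real
              ((ell2_norm (\<lambda>n. (u (n + 1) t - u (n - 1) t) / 2))\<^sup>2 +
               (ell2_norm (\<lambda>n. (u n (t + 1) - u n (t - 1)) / 2))\<^sup>2)) \<and>
         (\<forall>s t. wave_energy_finite u s \<and> wave_energy_finite u t \<longrightarrow>
            wave_energy u s = wave_energy u t)"
proof -
  have energy: "wave_energy u t = complex_of_real
              ((ell2_norm (\<lambda>n. (u (n + 1) t - u (n - 1) t) / 2))\<^sup>2 +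
               (ell2_norm (\<lambda>n. (u n (t + 1) - u n (t - 1)) / 2))\<^sup>2)"
    if "wave_energy_finite u t" for t
    using that summation_by_parts_step2[of "\<lambda>n. u n t"]
    unfolding wave_energy_finite_def wave_energy_def ell2_norm_square by simp
  have waves: "wave_energy u t = complex_of_real
      (((ell2_norm (left_wave u t))\<^sup>2 + (ell2_norm (right_wave u t))\<^sup>2) / 2)"
    if "wave_energy_finite u t" for t
  proof -
    have "left_wave u t =
        (\<lambda>n. (u (n + 1) t - u (n - 1) t) / 2 + (u n (t + 1) - u n (t - 1)) / 2)"
      and "right_wave u t =
        (\<lambda>n. (u (n + 1) t - u (n - 1) t) / 2 - (u n (t + 1) - u n (t - 1)) / 2)"
      using left_wave_eq[OF assms] right_wave_eq[OF assms] by auto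
    moreover have "in_ell2 (\<lambda>n. (u (n + 1) t - u (n - 1) t) / 2)"
      and "in_ell2 (\<lambda>n. (u n (t + 1) - u n (t - 1)) / 2)"
      using that unfolding wave_energy_finite_def by blast+
    ultimately show ?thesis
      unfolding energy[OF that] by (simp only: ell2_parallelogram) simp
  qed
  show ?thesis
  proof (intro conjI allI impI)
    fix s t assume "wave_energy_finite u s \<and> wave_energy_finite u t"
    then show "wave_energy u s = wave_energy u t"
      using ell2_norm_left_wave_const[OF assms, of s t]
        ell2_norm_right_wave_const[OF assms, of s t]
      by (simp only: waves)
  qed (rule energy)
qed

end
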